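(* Let $a,b,c$ be complex numbers and let $(g(x),xg(x))$ be the Bell pseudo-involution whose $B$-sequence has generating function $$B(x)=\frac{a-cx}{1+bx}.$$ Then $g(x)$ can be expressed as the continued fraction $$g(x)=\cfrac{1}{1-ax-bx^2+\cfrac{x^2(b+cx)}{1-ax-bx^2+\cfrac{x^2(b+cx)}{1-ax-bx^2+\cdots}}}.$$
   Context: All power series are formal, with complex coefficients. The infinite continued fraction is the limit of its finite truncations in the $x$-adic topology on formal power series. Riordan arrays: for $g(x)=1+g_1x+\cdots$ and $f(x)=f_1x+f_2x^2+\cdots$ with $f_1\neq 0$, the Riordan array $(g(x),f(x))$ is the infinite lower triangular matrix with entries $t_{n,k}=[x^n]\,g(x)f(x)^k$, $n,k\ge 0$. The product of Riordan arrays is $(g,f)\cdot(u,v)=(g(x)u(f(x)),v(f(x)))$, and the identity is $(1,x)$. A Bell array is a Riordan array of the form $(g(x),xg(x))$ with $g(0)=1$. It is a Bell pseudo-involution if $(g(x),-xg(x))^2=(1,x)$. $B$-sequence: the $B$-sequence of a Bell pseudo-involution $(g(x),xg(x))$ with entries $t_{n,k}$ is the sequence $b_0,b_1,b_2,\ldots$ such that, for all $n,k\ge 0$, $$t_{n+1,k}=t_{n,k-1}+\sum_{j\ge 0} b_j\, t_{n-j,k+j},$$ where $t_{n,-1}=0$ and $t_{m,l}=0$ whenever $m<0$ or $l>m$. Its generating function is $B(x)=\sum_{j\ge0} b_jx^j$. *)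

theory Defs
  imports Complex_Main "HOL-Computational_Algebra.Formal_Power_Series"
begin

text \<open>A Riordan array is represented by its pair of power series; \<open>riordan_entry\<close> gives
  the entries of the associated lower triangular matrix.\<close>

definition is_riordan :: "complex fps \<times> complex fps \<Rightarrow> bool" where
  "is_riordan = (\<lambda>(g, f). fps_nth g 0 = 1 \<and> fps_nth f 0 = 0 \<and> fps_nth f 1 \<noteq> 0)"

definition riordan_entry :: "complex fps \<times> complex fps \<Rightarrow> nat \<Rightarrow> nat \<Rightarrow> complex" where
  "riordan_entry = (\<lambda>(g, f) n k. fps_nth (g * f ^ k) n)"

definition riordan_mult ::
    "complex fps \<times> complex fps \<Rightarrow> complex fps \<times> complex fps \<Rightarrow> complex fps \<times> complex fps" where
  "riordan_mult = (\<lambda>(g, f) (u, v). (g * fps_compose u f, fps_compose v f))"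

definition riordan_one :: "complex fps \<times> complex fps" where
  "riordan_one = (1, fps_X)"

definition is_bell_array :: "complex fps \<times> complex fps \<Rightarrow> bool" where
  "is_bell_array R \<longleftrightarrow> is_riordan R \<and> snd R = fps_X * fst R"

definition is_bell_pseudo_involution :: "complex fps \<times> complex fps \<Rightarrow> bool" where
  "is_bell_pseudo_involution R \<longleftrightarrow> is_bell_array R \<and>
     riordan_mult (fst R, - (fps_X * fst R)) (fst R, - (fps_X * fst R)) = riordan_one"

text \<open>The sum is cut at \<open>j = n\<close> because entries with a negative row index are \<open>0\<close>; for \<open>j \<le> n\<close>
  the natural-number subtraction \<open>n - j\<close> is exact. Entries above the diagonal vanish
  for every Riordan array.\<close>

definition is_B_sequence :: "complex fps \<times> complex fps \<Rightarrow> (nat \<Rightarrow> complex) \<Rightarrow> bool" where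
  "is_B_sequence R \<beta> \<longleftrightarrow> (\<forall>n k. riordan_entry R (n + 1) k =
     (if k = 0 then 0 else riordan_entry R n (k - 1)) +
     (\<Sum>j\<le>n. \<beta> j * riordan_entry R (n - j) (k + j)))"

text \<open>\<open>cfrac_trunc p q n\<close> is the truncation with \<open>n\<close> levels of
  \<open>p 0 / (q 0 + p 1 / (q 1 + p 2 / (q 2 + \<dots>)))\<close>.\<close>

primrec cfrac_trunc ::
    "(nat \<Rightarrow> complex fps) \<Rightarrow> (nat \<Rightarrow> complex fps) \<Rightarrow> nat \<Rightarrow> complex fps" where
  "cfrac_trunc p q 0 = 0"
| "cfrac_trunc p q (Suc n) =
     p 0 / (q 0 + cfrac_trunc (\<lambda>i. p (Suc i)) (\<lambda>i. q (Suc i)) n)"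

text \<open>The limit is taken in the library's metric topology on formal power series, which is
  the \<open>x\<close>-adic one.\<close>

definition has_cfrac_expansion ::
    "complex fps \<Rightarrow> (nat \<Rightarrow> complex fps) \<Rightarrow> (nat \<Rightarrow> complex fps) \<Rightarrow> bool" where
  "has_cfrac_expansion g p q \<longleftrightarrow> cfrac_trunc p q \<longlonglongrightarrow> g"

end

theory Submission
  imports Defs
begin

text \<open>
  The column \<open>k = 0\<close> of the \<open>B\<close>-sequence recurrence says \<open>g = 1 + x g B(x\<^sup>2 g)\<close>. For the given
  rational \<open>B\<close>, clearing the denominator turns this into \<open>g (q + P g) = 1\<close> with
  \<open>q = 1 - a x - b x\<^sup>2\<close> and \<open>P = x\<^sup>2 (b + c x)\<close>, so \<open>h = P g\<close> is a fixed point of \<open>t \<mapsto> P / (q + t)\<close>.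
  Since \<open>h\<close> has zero constant term, this map is an \<open>x\<close>-adic contraction towards \<open>h\<close>.
\<close>

text \<open>As \<open>y\<close> has zero constant term, \<open>y ^ j\<close> starts at degree
  \<open>j\<close> or later. The coefficient sums of the composition can therefore all be extended
  to the common range up to \<open>n\<close>, and then swapped.\<close>

lemma fps_mult_compose_nth:
  fixes g B y :: "'a::comm_ring_1 fps"
  assumes "fps_nth y 0 = 0"
  shows "fps_nth (g * fps_compose B y) n = (\<Sum>j\<le>n. fps_nth B j * fps_nth (g * y ^ j) n)"
proof -
  have "fps_nth (g * fps_compose B y) n =
      (\<Sum>i=0..n. fps_nth g i * (\<Sum>j=0..n. fps_nth B j * fps_nth (y ^ j) (n - i)))"
    unfolding fps_mult_nth fps_compose_nth
    by (intro sum.cong refl arg_cong2[where f = "(*)"] sum.mono_neutral_left)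
       (use startsby_zero_power_prefix[OF assms] in auto)
  also have "\<dots> = (\<Sum>j=0..n. fps_nth B j * (\<Sum>i=0..n. fps_nth g i * fps_nth (y ^ j) (n - i)))"
    unfolding sum_distrib_left by (subst sum.swap) (simp add: mult_ac)
  finally show ?thesis
    by (simp add: fps_mult_nth atMost_atLeast0)
qed

text \<open>This is the generating function of column \<open>k = 0\<close>. The shift by
  \<open>x^j\<close> in \<open>x^j (x g)^j = (x^2 g)^j\<close> moves the entry in row
  \<open>n - j\<close> to degree \<open>n\<close>, so the recurrence sum becomes a coefficient of a
  composition.\<close>

lemma B_sequence_functional_equation:
  assumes "is_B_sequence (g, fps_X * g) \<beta>" "fps_nth g 0 = 1"
  shows "g = 1 + fps_X * (g * fps_compose (Abs_fps \<beta>) (fps_X ^ 2 * g))"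
proof (rule fps_ext)
  fix m
  show "fps_nth g m = fps_nth (1 + fps_X * (g * fps_compose (Abs_fps \<beta>) (fps_X ^ 2 * g))) m"
  proof (cases m)
    case 0
    then show ?thesis using assms(2) by simp
  next
    case (Suc n)
    have "fps_nth (g * (fps_X ^ 2 * g) ^ j) n = fps_nth (g * (fps_X * g) ^ j) (n - j)"
      if "j \<le> n" for j
    proof -
      have "g * (fps_X ^ 2 * g) ^ j = fps_X ^ j * (g * (fps_X * g) ^ j)"
        by (simp add: power_mult_distrib power2_eq_square mult_ac)
      then show ?thesis
        using that by (simp only: fps_X_power_mult_nth) simp
    qed
    then have "fps_nth (g * fps_compose (Abs_fps \<beta>) (fps_X ^ 2 * g)) n =
        (\<Sum>j\<le>n. \<beta> j * fps_nth (g * (fps_X * g) ^ j) (n - j))"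
      by (simp add: fps_mult_compose_nth)
    also have "\<dots> = fps_nth g (Suc n)"
      using assms(1)[unfolded is_B_sequence_def, rule_format, of n 0]
      by (simp add: riordan_entry_def)
    finally show ?thesis
      using Suc by simp
  qed
qed

lemma quadratic_equation_of_rational_B_sequence:
  assumes "is_B_sequence (g, fps_X * g) \<beta>" "fps_nth g 0 = 1"
    and "Abs_fps \<beta> = (fps_const a - fps_const c * fps_X) / (1 + fps_const b * fps_X)"
  shows "g * ((1 - fps_const a * fps_X - fps_const b * fps_X ^ 2) +
    fps_X ^ 2 * (fps_const b + fps_const c * fps_X) * g) = 1"
proof -
  define y where "y = fps_X ^ 2 * g"
  have y0: "fps_nth y 0 = 0"
    by (simp add: y_def)
  define C where "C = fps_compose (Abs_fps \<beta>) y"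
  have "Abs_fps \<beta> * (1 + fps_const b * fps_X) = fps_const a - fps_const c * fps_X"
    unfolding assms(3) by (simp add: fps_divide_unit mult.assoc inverse_mult_eq_1)
  then have "fps_compose (Abs_fps \<beta> * (1 + fps_const b * fps_X)) y =
      fps_compose (fps_const a - fps_const c * fps_X) y"
    by simp
  \<comment> \<open>Composition with \<open>y\<close> is a ring homomorphism, so the denominator is
    cleared before substituting and no quotient has to be composed.\<close>
  then have C: "C * (1 + fps_const b * y) = fps_const a - fps_const c * y"
    by (simp add: C_def fps_compose_mult_distrib[OF y0] fps_compose_add_distrib
        fps_compose_sub_distrib y0)
  have "g = 1 + fps_X * (g * C)"
    unfolding C_def y_def by (rule B_sequence_functional_equation[OF assms(1,2)])
  then have "g - 1 = fps_X * g * C"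
    by (metis add_diff_cancel_left' mult.assoc)
  then have "(g - 1) * (1 + fps_const b * y) = fps_X * g * (C * (1 + fps_const b * y))"
    by (simp only: mult.assoc)
  then show ?thesis
    unfolding C unfolding y_def by (simp add: algebra_simps power2_eq_square)
qed

text \<open>Here \<open>h\<close> plays the role of \<open>P / v\<close>. The factor
  \<open>u - v\<close> lets an error in a denominator pass to the quotient.\<close>

lemma diff_fps_divide_unit:
  fixes u v h P :: "'a::field fps"
  assumes "h * v = P" "fps_nth u 0 \<noteq> 0"
  shows "h - P / u = h * (u - v) * inverse u"
proof -
  have "h - P / u = h * (u * inverse u) - h * v * inverse u"
    using assms by (simp add: fps_divide_unit inverse_mult_eq_1')
  then show ?thesis
    by (simp add: algebra_simps)
qed

lemma fps_X_dvd_iff: "fps_X dvd f \<longleftrightarrow> fps_nth f 0 = 0" for f :: "'a::field fps"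
  using fps_dvd_iff[of fps_X f]
  by (cases "f = 0") (auto simp: Suc_le_eq subdegree_eq_0_iff)

text \<open>The error of the next truncation is the previous error times \<open>h\<close> and a
  unit, and \<open>h\<close> contributes a further factor \<open>x\<close>. The induction starts
  from \<open>x\<close> dividing \<open>h - 0\<close>.\<close>

lemma fps_X_power_dvd_diff_cfrac_trunc:
  assumes "h * (q + h) = P" "fps_nth h 0 = 0" "fps_nth q 0 \<noteq> 0"
  shows "fps_X ^ Suc n dvd h - cfrac_trunc (\<lambda>_. P) (\<lambda>_. q) n"
proof (induction n)
  case 0
  then show ?case
    using assms(2) by (simp add: fps_X_dvd_iff)
next
  case (Suc n)
  define T where "T = cfrac_trunc (\<lambda>_. P) (\<lambda>_. q) n"
  have "fps_X dvd h - T"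
    using dvd_trans[OF _ Suc.IH] by (simp add: T_def)
  then have "fps_nth (q + T) 0 \<noteq> 0"
    using assms(2,3) by (simp add: fps_X_dvd_iff)
  then have "h - P / (q + T) = h * ((q + T) - (q + h)) * inverse (q + T)"
    by (rule diff_fps_divide_unit[OF assms(1)])
  also have "\<dots> = h * (h - T) * - inverse (q + T)"
    by (simp add: algebra_simps)
  also have "fps_X * fps_X ^ Suc n dvd \<dots>"
    using assms(2) Suc.IH by (intro dvd_mult2 mult_dvd_mono) (simp_all add: fps_X_dvd_iff T_def)
  finally show ?case
    by (simp add: T_def)
qed

lemma fps_LIMSEQ_if_fps_X_power_dvd:
  fixes f :: "nat \<Rightarrow> 'a::comm_ring_1 fps"
  assumes "\<And>n. fps_X ^ n dvd g - f n"
  shows "f \<longlonglongrightarrow> g"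
proof (rule tendsto_fpsI)
  fix m
  have "fps_nth (f n) m = fps_nth g m" if "n > m" for n
  proof -
    obtain k where "g - f n = fps_X ^ n * k"
      using assms[of n] by (elim dvdE)
    then have "fps_nth (g - f n) m = 0"
      using that by (simp add: fps_X_power_mult_nth)
    then show ?thesis by simp
  qed
  then show "\<forall>\<^sub>F n in sequentially. fps_nth (f n) m = fps_nth g m"
    by (intro eventually_sequentiallyI[of "Suc m"]) simp
qed

theorem corollary3:
  fixes a b c :: complex and g :: "complex fps" and \<beta> :: "nat \<Rightarrow> complex"
  assumes "is_bell_pseudo_involution (g, fps_X * g)"
    and "is_B_sequence (g, fps_X * g) \<beta>"
    and "Abs_fps \<beta> = (fps_const a - fps_const c * fps_X) / (1 + fps_const b * fps_X)"
  shows "has_cfrac_expansion g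
    (\<lambda>i. if i = 0 then 1 else fps_X ^ 2 * (fps_const b + fps_const c * fps_X))
    (\<lambda>i. 1 - fps_const a * fps_X - fps_const b * fps_X ^ 2)"
proof -
  define q where "q = 1 - fps_const a * fps_X - fps_const b * fps_X ^ 2"
  define P where "P = fps_X ^ 2 * (fps_const b + fps_const c * fps_X)"
  define T where "T = cfrac_trunc (\<lambda>_. P) (\<lambda>_. q)"
  have "fps_nth g 0 = 1"
    using assms(1) by (simp add: is_bell_pseudo_involution_def is_bell_array_def is_riordan_def)
  from quadratic_equation_of_rational_B_sequence[OF assms(2) this assms(3)]
  have g: "g * (q + P * g) = 1"
    by (simp add: q_def P_def)
  have "P * g * (q + P * g) = P * (g * (q + P * g))"
    by (simp only: mult.assoc)
  then have h: "P * g * (q + P * g) = P"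
    by (simp add: g)
  have q0: "fps_nth q 0 = 1" and P0: "fps_nth P 0 = 0"
    by (simp_all add: q_def P_def power2_eq_square)
  have dvd: "fps_X ^ Suc n dvd P * g - T n" for n
    unfolding T_def using fps_X_power_dvd_diff_cfrac_trunc[OF h] q0 P0 by simp
  have "fps_X ^ n dvd g - 1 / (q + T n)" for n
  proof -
    have "fps_X dvd P * g - T n"
      using dvd_trans[OF _ dvd[of n]] by simp
    then have "fps_nth (q + T n) 0 \<noteq> 0"
      using q0 P0 by (simp add: fps_X_dvd_iff)
    then have "g - 1 / (q + T n) = g * ((q + T n) - (q + P * g)) * inverse (q + T n)"
      by (rule diff_fps_divide_unit[OF g])
    \<comment> \<open>The outermost numerator is 1 instead of \<open>P\<close>, so this level gains
      no power of \<open>x\<close> but inherits the divisibility of the tail error.\<close>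
    also have "\<dots> = (P * g - T n) * (- g * inverse (q + T n))"
      by (simp add: algebra_simps)
    also have "fps_X ^ n dvd \<dots>"
      using dvd_trans[OF _ dvd[of n]] by (intro dvd_mult2) simp
    finally show ?thesis .
  qed
  then have "(\<lambda>n. 1 / (q + T n)) \<longlonglongrightarrow> g"
    by (rule fps_LIMSEQ_if_fps_X_power_dvd)
  \<comment> \<open>Unfolding one level leaves the constant tail \<open>T n\<close>; the shift to
    \<open>Suc n\<close> does not affect the limit.\<close>
  then have "(\<lambda>n. cfrac_trunc (\<lambda>i. if i = 0 then 1 else P) (\<lambda>_. q) (Suc n)) \<longlonglongrightarrow> g"
    by (simp add: T_def)
  then have "cfrac_trunc (\<lambda>i. if i = 0 then 1 else P) (\<lambda>_. q) \<longlonglongrightarrow> g"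
    by (rule LIMSEQ_imp_Suc)
  then show ?thesis
    unfolding has_cfrac_expansion_def q_def P_def .
qed

end
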